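(* Let $k\ge 1$ and $n\ge 1$ be integers. Suppose there are $N$ coins, exactly one of which is fake, it is not known whether the fake coin is heavier or lighter than the genuine ones, and there are no extra coins known to be genuine. If $$3\le N\le \frac{(2k+1)^n+1}{2}-k,$$ then, using $k$ balance scales in parallel, there is a strategy that is guaranteed to find the fake coin in $n$ minutes.
   Context: All genuine coins have the same weight; exactly one coin is fake, and it is either lighter or heavier than a genuine coin. The task is only to find the fake coin, not to decide whether it is lighter or heavier. There are $k$ two-pan balance scales usable simultaneously. In each minute each scale may be used for one weighing; in a given minute each coin is placed on at most one pan of at most one scale, and each weighing puts the same number of coins on its two pans. Each weighing reports that the pans balance, or which pan is lighter. Strategies may be adaptive: the weighings in a minute may depend on all results from earlier minutes. *)

theory Defs
  imports Complex_Main
begin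

text \<open>Coins are the numbers below N, scales the numbers below k.\<close>

datatype pan = Left_Pan | Right_Pan

datatype outcome = Balance | Lighter pan

text \<open>A placement describes one minute: it sends a coin to its scale and pan, or to None if
  the coin is left aside. Hence a coin lies on at most one pan of at most one scale. A scale that
  is not used in that minute has two empty pans (and reports Balance).\<close>

type_synonym placement = "nat \<Rightarrow> (nat \<times> pan) option"

definition pan_coins :: "nat \<Rightarrow> placement \<Rightarrow> nat \<Rightarrow> pan \<Rightarrow> nat set" where
  "pan_coins N p s b = {c. c < N \<and> p c = Some (s, b)}"

definition valid_placement :: "nat \<Rightarrow> nat \<Rightarrow> placement \<Rightarrow> bool" where
  "valid_placement N k p \<longleftrightarrow>
     (\<forall>c s b. c < N \<longrightarrow> p c = Some (s, b) \<longrightarrow> s < k) \<and>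
     (\<forall>s<k. card (pan_coins N p s Left_Pan) = card (pan_coins N p s Right_Pan))"

definition fake_coin :: "nat \<Rightarrow> (nat \<Rightarrow> real) \<Rightarrow> nat \<Rightarrow> bool" where
  "fake_coin N w f \<longleftrightarrow>
     f < N \<and> w f > 0 \<and> (\<exists>g>0. w f \<noteq> g \<and> (\<forall>c<N. c \<noteq> f \<longrightarrow> w c = g))"

definition pan_weight :: "nat \<Rightarrow> (nat \<Rightarrow> real) \<Rightarrow> placement \<Rightarrow> nat \<Rightarrow> pan \<Rightarrow> real" where
  "pan_weight N w p s b = (\<Sum>c\<in>pan_coins N p s b. w c)"

definition weigh :: "nat \<Rightarrow> (nat \<Rightarrow> real) \<Rightarrow> placement \<Rightarrow> nat \<Rightarrow> outcome" where
  "weigh N w p s =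
     (if pan_weight N w p s Left_Pan < pan_weight N w p s Right_Pan then Lighter Left_Pan
      else if pan_weight N w p s Right_Pan < pan_weight N w p s Left_Pan then Lighter Right_Pan
      else Balance)"

text \<open>The results of one minute are listed scale by scale, and a history lists the results of
  the minutes so far, earliest first. An adaptive strategy chooses the next placement from the
  history.\<close>

type_synonym history = "outcome list list"

type_synonym strategy = "history \<Rightarrow> placement"

primrec run :: "nat \<Rightarrow> nat \<Rightarrow> strategy \<Rightarrow> (nat \<Rightarrow> real) \<Rightarrow> nat \<Rightarrow> history" where
  "run N k \<sigma> w 0 = []"
| "run N k \<sigma> w (Suc m) =
     run N k \<sigma> w m @ [map (weigh N w (\<sigma> (run N k \<sigma> w m))) [0..<k]]"

text \<open>The verdict sees only the history, and is the same function for every possible fake coin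
  and for both a lighter and a heavier fake.\<close>

definition finds_fake :: "nat \<Rightarrow> nat \<Rightarrow> nat \<Rightarrow> strategy \<Rightarrow> (history \<Rightarrow> nat) \<Rightarrow> bool" where
  "finds_fake N k n \<sigma> verdict \<longleftrightarrow>
     (\<forall>h. valid_placement N k (\<sigma> h)) \<and>
     (\<forall>w f. fake_coin N w f \<longrightarrow> verdict (run N k \<sigma> w n) = f)"

end

theory Submission
  imports Defs
begin

text \<open>Write \<open>M = 2 k + 1\<close>. The state of knowledge is a set of candidates, that is, of pairs of a coin
  and a direction (lighter or heavier) that agree with all results so far. As a single coin is
  fake, at most one scale tips, and a minute splits the candidates into \<open>M\<close> classes:
  one for each pan that may rise, and one for a general balance (\<open>solvable_SucI\<close>). It
  suffices to find a decision tree on these sets, which \<open>solvable_strategy\<close> turns into a strategy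
  and a verdict.

  Once some scale has tipped, each suspect has a known direction. Then \<open>j\<close> minutes suffice
  for \<open>M ^ j\<close> suspects if one genuine coin is known (\<open>solvable_labelled\<close>): equally labelled coins
  are opposed to each other in pairs, and a tip clears one coin of each pair.

  As long as everything balances, the suspects have unknown directions, and weighed ones are cleared
  altogether. With a supply of genuine coins, \<open>j\<close> minutes suffice for \<open>(M ^ j + 1) / 2\<close> of them
  (\<open>solvable_unknown\<close>): put \<open>m = M ^ (j - 1)\<close> suspects on each scale, so that a tip leaves
  \<open>m\<close> labelled ones and a balance leaves \<open>(M ^ j + 1) / 2 - k m = (m + 1) / 2\<close>. In the very first
  minute there is no genuine coin to complete an odd load, so a scale takes only \<open>m - 1\<close> coins; this
  is the loss of \<open>k\<close> in the bound (\<open>solvable_all\<close>). From \<open>N \<ge> 3\<close> it follows that at least two coins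
  can be weighed while another one stays aside, so that either result reveals a genuine coin.\<close>

section \<open>Weighings as a partition of the candidates\<close>

text \<open>The flag is true if the coin is lighter, and false if it is heavier.\<close>

type_synonym candidate = "nat \<times> bool"

fun opposite :: "pan \<Rightarrow> pan" where
  "opposite Left_Pan = Right_Pan"
| "opposite Right_Pan = Left_Pan"

lemma opposite_opposite [simp]: "opposite (opposite b) = b"
  by (cases b) auto

lemma opposite_neq [simp]: "opposite b \<noteq> b" "b \<noteq> opposite b"
  by (cases b; simp)+

lemma opposite_eq_iff [simp]: "opposite a = opposite b \<longleftrightarrow> a = b"
  by (cases a; cases b) auto

text \<open>The argument \<open>b\<close> is the pan on which the coin lies. For a fixed candidate this is an involution,
  so it also gives the pan on which the coin must lie for \<open>b\<close> to rise.\<close>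

definition rising_pan :: "candidate \<Rightarrow> pan \<Rightarrow> pan" where
  "rising_pan x b = (if snd x then b else opposite b)"

definition predicted :: "placement \<Rightarrow> candidate \<Rightarrow> nat \<Rightarrow> outcome" where
  "predicted p x s =
     (case p (fst x) of None \<Rightarrow> Balance
      | Some (t, b) \<Rightarrow> if t = s then Lighter (rising_pan x b) else Balance)"

lemma pan_weight_fake:
  assumes "f < N" "\<forall>c<N. c \<noteq> f \<longrightarrow> w c = g"
  shows "pan_weight N w p s b =
    g * card (pan_coins N p s b) + (if p f = Some (s, b) then w f - g else 0)"
proof -
  let ?A = "pan_coins N p s b"
  have fin: "finite ?A" unfolding pan_coins_def by simp
  have "pan_weight N w p s b = (\<Sum>c\<in>?A. g + (if c = f then w f - g else 0))"
    unfolding pan_weight_def using assms by (intro sum.cong) (auto simp: pan_coins_def)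
  also have "\<dots> = g * card ?A + (if f \<in> ?A then w f - g else 0)"
    using fin by (simp add: sum.distrib)
  finally show ?thesis using assms by (simp add: pan_coins_def)
qed

lemma weigh_eq_predicted:
  assumes "f < N" "\<forall>c<N. c \<noteq> f \<longrightarrow> w c = g" "w f \<noteq> g"
    and "valid_placement N k p" "s < k"
  shows "weigh N w p s = predicted p (f, w f < g) s"
proof -
  have "card (pan_coins N p s Left_Pan) = card (pan_coins N p s Right_Pan)"
    using assms by (simp add: valid_placement_def)
  then show ?thesis
    unfolding weigh_def predicted_def rising_pan_def
      pan_weight_fake[OF assms(1,2)]
    using assms(3) by (cases "p f"; cases "snd (the (p f))") (auto split: if_splits)
qed

section \<open>Decision trees\<close>

text \<open>Only the coin has to be identified, so a leaf may contain both directions of one coin.\<close>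

primrec solvable :: "nat \<Rightarrow> nat \<Rightarrow> nat \<Rightarrow> candidate set \<Rightarrow> bool" where
  "solvable N k 0 S = (\<exists>c. \<forall>x\<in>S. fst x = c)"
| "solvable N k (Suc j) S = (\<exists>p. valid_placement N k p \<and>
     (\<forall>r. solvable N k j {x \<in> S. map (predicted p x) [0..<k] = r}))"

lemma solvable_mono: "solvable N k j T \<Longrightarrow> S \<subseteq> T \<Longrightarrow> solvable N k j S"
proof (induction j arbitrary: S T)
  case 0
  then show ?case by auto
next
  case (Suc j)
  then obtain p where p: "valid_placement N k p"
    and T: "\<And>r. solvable N k j {x \<in> T. map (predicted p x) [0..<k] = r}" by auto
  have "solvable N k j {x \<in> S. map (predicted p x) [0..<k] = r}" for r
    by (rule Suc.IH[OF T[of r]]) (use Suc.prems in auto)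
  with p show ?case by auto
qed

lemma solvable_empty: "solvable N k j {}"
proof (induction j)
  case (Suc j)
  have "valid_placement N k (\<lambda>_. None)"
    by (simp add: valid_placement_def pan_coins_def)
  with Suc show ?case by auto
qed simp

text \<open>Since only one coin is fake, at most one scale can tip: a minute therefore has only
  \<open>2 k + 1\<close> possible results, one for each pan that may rise and one for a general balance.\<close>

lemma solvable_SucI:
  assumes p: "valid_placement N k p" and S: "fst ` S \<subseteq> {..<N}"
    and aside: "solvable N k j {x \<in> S. p (fst x) = None}"
    and tips: "\<And>s b. s < k \<Longrightarrow>
      solvable N k j {x \<in> S. p (fst x) = Some (s, rising_pan x b)}"
  shows "solvable N k (Suc j) S"
proof -
  have "solvable N k j {x \<in> S. map (predicted p x) [0..<k] = r}" (is "solvable N k j ?C") for r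
  proof (cases "?C = {}")
    case True
    then show ?thesis by (simp only: solvable_empty)
  next
    case False
    then obtain x where x: "x \<in> S" "map (predicted p x) [0..<k] = r" by blast
    have same: "predicted p y s = predicted p x s" if "y \<in> ?C" "s < k" for y s
    proof -
      have "map (predicted p y) [0..<k] = map (predicted p x) [0..<k]"
        using that x by simp
      then show ?thesis using that(2) by simp
    qed
    have bound: "s < k" if "y \<in> S" "p (fst y) = Some (s, b)" for y s b
    proof -
      have "fst y < N" using S that(1) by auto
      then show ?thesis using p that(2) unfolding valid_placement_def by blast
    qed
    show ?thesis
    proof (cases "p (fst x)")
      case None
      have "p (fst y) = None" if y: "y \<in> ?C" for y
      proof (cases "p (fst y)")
        case (Some tb)
        obtain t b where tb: "tb = (t, b)" by force
        have "t < k" using y Some tb bound by blast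
        from same[OF y this] show ?thesis using None Some tb by (simp add: predicted_def)
      qed
      then show ?thesis by (intro solvable_mono[OF aside]) auto
    next
      case (Some sb)
      obtain s b where sb: "sb = (s, b)" by force
      have s: "s < k" using x Some sb bound by blast
      have "p (fst y) = Some (s, rising_pan y (rising_pan x b))" if y: "y \<in> ?C" for y
        using same[OF y s] Some sb
        by (auto simp: predicted_def rising_pan_def split: option.splits prod.splits if_splits)
      then show ?thesis by (intro solvable_mono[OF tips[OF s, of "rising_pan x b"]]) auto
    qed
  qed
  with p show ?thesis by auto
qed

text \<open>Decision trees grow from the first minute, whereas a run grows at its end.\<close>

lemma run_Suc_shift:
  "run N k \<sigma> w (Suc m) =
     map (weigh N w (\<sigma> [])) [0..<k] #
     run N k (\<lambda>h. \<sigma> (map (weigh N w (\<sigma> [])) [0..<k] # h)) w m"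
proof (induction m)
  case (Suc m)
  show ?case
    by (subst run.simps(2)) (simp only: Suc, simp)
qed simp

lemma solvable_strategy:
  assumes "solvable N k n S"
  shows "\<exists>\<sigma> verdict. (\<forall>h. valid_placement N k (\<sigma> h)) \<and>
    (\<forall>w f g. f < N \<longrightarrow> w f \<noteq> g \<longrightarrow> (\<forall>c<N. c \<noteq> f \<longrightarrow> w c = g) \<longrightarrow> (f, w f < g) \<in> S \<longrightarrow>
       verdict (run N k \<sigma> w n) = f)"
  using assms
proof (induction n arbitrary: S)
  case 0
  then obtain c where c: "\<forall>x\<in>S. fst x = c" by auto
  have "valid_placement N k (\<lambda>_. None)"
    by (simp add: valid_placement_def pan_coins_def)
  with c show ?case
    by (intro exI[of _ "\<lambda>_ _. None"] exI[of _ "\<lambda>_. c"]) auto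
next
  case (Suc n)
  then obtain p where p: "valid_placement N k p"
    and sub: "\<And>r. solvable N k n {x \<in> S. map (predicted p x) [0..<k] = r}" by auto
  from Suc.IH[OF sub] obtain \<sigma> v where
    valid: "\<And>r h. valid_placement N k (\<sigma> r h)" and
    v: "\<And>r w f g. \<lbrakk>f < N; w f \<noteq> g; \<forall>c<N. c \<noteq> f \<longrightarrow> w c = g; (f, w f < g) \<in> S;
          map (predicted p (f, w f < g)) [0..<k] = r\<rbrakk>
        \<Longrightarrow> v r (run N k (\<sigma> r) w n) = f"
    by simp metis
  let ?\<sigma> = "\<lambda>h. case h of [] \<Rightarrow> p | r # h' \<Rightarrow> \<sigma> r h'"
  let ?v = "\<lambda>h. v (hd h) (tl h)"
  have "valid_placement N k (?\<sigma> h)" for h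
    using p valid by (cases h) auto
  moreover have "?v (run N k ?\<sigma> w (Suc n)) = f"
    if f: "f < N" "w f \<noteq> g" "\<forall>c<N. c \<noteq> f \<longrightarrow> w c = g" "(f, w f < g) \<in> S" for w f g
  proof -
    have e: "map (weigh N w p) [0..<k] = map (predicted p (f, w f < g)) [0..<k]"
      using weigh_eq_predicted[OF f(1) f(3) f(2) p] by simp
    then show ?thesis
      by (simp only: run_Suc_shift list.case list.sel e v[OF f refl])
  qed
  ultimately show ?case
    by (intro exI[of _ ?\<sigma>] exI[of _ ?v]) blast
qed

section \<open>Filling the scales\<close>

definition pan_of :: "nat \<Rightarrow> pan" where
  "pan_of i = (if even i then Left_Pan else Right_Pan)"

lemma card_even_below: "card {r. r < n \<and> even r} = (n + 1) div 2"
proof (induction n)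
  case (Suc n)
  have "{r. r < Suc n \<and> even r} = {r. r < n \<and> even r} \<union> (if even n then {n} else {})"
    by (auto simp: less_Suc_eq)
  then show ?case using Suc by (simp add: card_insert_if)
qed simp

lemma card_odd_below: "card {r. r < n \<and> odd r} = n div 2"
proof (induction n)
  case (Suc n)
  have "{r. r < Suc n \<and> odd r} = {r. r < n \<and> odd r} \<union> (if odd n then {n} else {})"
    by (auto simp: less_Suc_eq)
  then show ?case using Suc by (simp add: card_insert_if)
qed simp

lemma block_eq:
  fixes d X s :: nat
  assumes "d > 0"
  shows "{i. i < X \<and> i div d = s \<and> P (i mod d)} =
    (\<lambda>r. s * d + r) ` {r. r < min d (X - s * d) \<and> P r}" (is "?A = ?f ` ?B")
proof (intro equalityI subsetI)
  fix i assume i: "i \<in> ?A"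
  then have e: "i = s * d + i mod d" by auto
  have "i < X" "P (i mod d)" using i by auto
  moreover have "i mod d < d" using assms by simp
  moreover have "i mod d < X - s * d" using e \<open>i < X\<close> by linarith
  ultimately have "i mod d \<in> ?B" by simp
  with e show "i \<in> ?f ` ?B" by blast
next
  fix i assume "i \<in> ?f ` ?B"
  then show "i \<in> ?A" by auto
qed

lemma card_block:
  fixes d X s :: nat
  assumes "d > 0"
  shows "card {i. i < X \<and> i div d = s \<and> P (i mod d)} = card {r. r < min d (X - s * d) \<and> P r}"
  unfolding block_eq[OF assms] by (intro card_image) (auto simp: inj_on_def)

text \<open>The one way in which pans are loaded: the first \<open>X\<close> coins of an enumeration \<open>z\<close> are cut
  into blocks of length \<open>d\<close>, one block to a scale, and a block is dealt alternately to the left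
  and the right pan. A block of odd length leaves the right pan one coin short, and scale \<open>s\<close> then
  borrows the genuine coin \<open>g s\<close>.\<close>

lemma block_placement:
  fixes z g :: "nat \<Rightarrow> nat"
  assumes z: "inj_on z {..<u}" "z ` {..<u} \<subseteq> {..<N}"
    and X: "X \<le> u" "X \<le> k * d" and d: "d > 0"
    and g: "inj_on g {..<v}" "g ` {..<v} \<subseteq> {..<N} - z ` {..<u}"
    and borrow: "\<And>s. s < k \<Longrightarrow> odd (min d (X - s * d)) \<Longrightarrow> s < v"
  obtains p where "valid_placement N k p"
    and "\<And>i. i < u \<Longrightarrow>
      p (z i) = (if i < X then Some (i div d, pan_of (i mod d)) else None)"
proof -
  define odd_scales where "odd_scales = {s. s < k \<and> odd (min d (X - s * d))}"
  define p where "p = (\<lambda>c.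
    if c \<in> z ` {..<X} then
      (let i = inv_into {..<X} z c in Some (i div d, pan_of (i mod d)))
    else if c \<in> g ` odd_scales then Some (inv_into odd_scales g c, Right_Pan) else None)"
  have odd_scales_v: "odd_scales \<subseteq> {..<v}" using borrow by (auto simp: odd_scales_def)
  have inj_z: "inj_on z {..<X}" using z(1) by (rule inj_on_subset) (use X in auto)
  have inj_g: "inj_on g odd_scales" using g(1) odd_scales_v by (rule inj_on_subset)
  have pz: "p (z i) = Some (i div d, pan_of (i mod d))" if "i < X" for i
    using that inj_z by (simp add: p_def)
  have g_notin: "g s \<notin> z ` {..<u}" if "s \<in> odd_scales" for s using that g(2) odd_scales_v by blast
  have zX: "z ` {..<X} \<subseteq> z ` {..<u}" using X by auto
  have pg: "p (g s) = Some (s, Right_Pan)" if "s \<in> odd_scales" for s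
    using that inj_g g_notin[OF that] zX by (auto simp: p_def)
  have div_less: "i div d < k" if "i < X" for i
    using that X d by (simp add: div_less_iff_less_mult)
  have zN: "z i < N" if "i < X" for i using that z(2) X by (auto simp: image_subset_iff)
  have gN: "g s < N" if "s \<in> odd_scales" for s using that g(2) odd_scales_v by blast
  have cases_p: "(\<exists>i<X. c = z i) \<or> (\<exists>s\<in>odd_scales. c = g s)" if "p c \<noteq> None" for c
    using that by (auto simp: p_def split: if_splits)
  have L: "pan_coins N p s Left_Pan = z ` {i. i < X \<and> i div d = s \<and> even (i mod d)}" for s
  proof (intro equalityI subsetI)
    fix c assume "c \<in> pan_coins N p s Left_Pan"
    then have c: "p c = Some (s, Left_Pan)" by (simp add: pan_coins_def)
    then show "c \<in> z ` {i. i < X \<and> i div d = s \<and> even (i mod d)}"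
      using cases_p[of c] pz pg by (auto simp: pan_of_def split: if_splits)
  qed (use pz zN in \<open>auto simp: pan_coins_def pan_of_def\<close>)
  have R: "pan_coins N p s Right_Pan =
      z ` {i. i < X \<and> i div d = s \<and> odd (i mod d)} \<union> g ` (odd_scales \<inter> {s})" for s
  proof (intro equalityI subsetI)
    fix c assume "c \<in> pan_coins N p s Right_Pan"
    then have c: "p c = Some (s, Right_Pan)" by (simp add: pan_coins_def)
    then show "c \<in> z ` {i. i < X \<and> i div d = s \<and> odd (i mod d)} \<union> g ` (odd_scales \<inter> {s})"
      using cases_p[of c] pz pg by (auto simp: pan_of_def split: if_splits)
  qed (use pz zN pg gN in \<open>auto simp: pan_coins_def pan_of_def\<close>)
  have "card (pan_coins N p s Left_Pan) = card (pan_coins N p s Right_Pan)" if s: "s < k" for s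
  proof -
    let ?m = "min d (X - s * d)"
    have cz: "card (z ` {i. i < X \<and> i div d = s \<and> P (i mod d)}) = card {r. r < ?m \<and> P r}" for P
    proof -
      have "inj_on z {i. i < X \<and> i div d = s \<and> P (i mod d)}"
        using inj_z by (rule inj_on_subset) auto
      then show ?thesis by (simp only: card_image card_block[OF d])
    qed
    have "card (pan_coins N p s Right_Pan) =
        card (z ` {i. i < X \<and> i div d = s \<and> odd (i mod d)}) + card (g ` (odd_scales \<inter> {s}))"
      unfolding R
    proof (rule card_Un_disjoint)
      show "z ` {i. i < X \<and> i div d = s \<and> odd (i mod d)} \<inter> g ` (odd_scales \<inter> {s}) = {}"
      proof (cases "s \<in> odd_scales")
        case True
        have "z i \<noteq> g s" if "i < X" for i
        proof -
          have "z i \<in> z ` {..<u}" using that X(1) by simp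
          then show ?thesis using g_notin[OF True] by metis
        qed
        then show ?thesis by fastforce
      qed simp
    qed auto
    also have "\<dots> = ?m div 2 + (if odd ?m then 1 else 0)"
      using s unfolding cz[of odd] card_odd_below by (auto simp: odd_scales_def)
    also have "\<dots> = (?m + 1) div 2" by (cases "even ?m") (auto elim: oddE)
    finally show ?thesis unfolding L cz[of even] card_even_below by simp
  qed
  moreover have "s < k" if "p c = Some (s, b)" for c s b
    using cases_p[of c] pz pg that div_less by (auto simp: odd_scales_def)
  ultimately have "valid_placement N k p" by (simp add: valid_placement_def)
  moreover have "p (z i) = (if i < X then Some (i div d, pan_of (i mod d)) else None)"
    if i: "i < u" for i
  proof (cases "i < X")
    case False
    have "z i \<notin> z ` {..<X}"
    proof
      assume "z i \<in> z ` {..<X}"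
      then obtain i' where i': "z i = z i'" "i' < X" by auto
      then have "i' < u" using X(1) by linarith
      then have "i = i'" using inj_onD[OF z(1) i'(1)] i by simp
      then show False using False i'(2) by simp
    qed
    moreover have "z i \<notin> g ` odd_scales" using g_notin i by (metis imageE imageI lessThan_iff)
    ultimately show ?thesis using False by (simp add: p_def)
  qed (simp add: pz)
  ultimately show ?thesis using that by blast
qed

section \<open>Coins whose possible deviation is known\<close>

lemma paired_enumeration:
  fixes C :: "nat set"
  assumes "finite C" "even (card {c \<in> C. lab c}) \<or> even (card {c \<in> C. \<not> lab c})"
  obtains z where "bij_betw z {..<card C} C"
    and "\<And>i. 2 * i + 1 < card C \<Longrightarrow> (lab (z (2 * i)) :: bool) = lab (z (2 * i + 1))"
proof -
  obtain A B where AB: "A \<union> B = C" "A \<inter> B = {}" "even (card A)"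
    and lab: "\<And>a b. a \<in> A \<Longrightarrow> b \<in> A \<Longrightarrow> lab a = lab b" "\<And>a b. a \<in> B \<Longrightarrow> b \<in> B \<Longrightarrow> lab a = lab b"
  proof (cases "even (card {c \<in> C. lab c})")
    case True
    show ?thesis by (rule that[of "{c \<in> C. lab c}" "{c \<in> C. \<not> lab c}"]) (use True in auto)
  next
    case False
    show ?thesis by (rule that[of "{c \<in> C. \<not> lab c}" "{c \<in> C. lab c}"]) (use False assms in auto)
  qed
  have fin: "finite A" "finite B" using AB assms(1) by auto
  define zs where "zs = sorted_list_of_set A @ sorted_list_of_set B"
  have zs: "distinct zs" "set zs = C" "length zs = card C"
    using fin AB by (auto simp: zs_def card_Un_disjoint)
  have "bij_betw ((!) zs) {..<card C} C"
    using zs bij_betw_nth by metis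
  moreover have "lab (zs ! (2 * i)) = lab (zs ! (2 * i + 1))" if i: "2 * i + 1 < card C" for i
  proof (cases "2 * i < card A")
    case True
    then have "2 * i + 1 < card A" using AB(3) by presburger
    then have "zs ! (2 * i) \<in> A" "zs ! (2 * i + 1) \<in> A"
      using fin(1) nth_mem[of _ "sorted_list_of_set A"] by (auto simp: zs_def nth_append)
    then show ?thesis by (rule lab(1))
  next
    case False
    have "card C = card A + card B" using AB fin card_Un_disjoint by metis
    then have "2 * i - card A < card B" "2 * i + 1 - card A < card B"  using i False by auto
    then have "zs ! (2 * i) \<in> B" "zs ! (2 * i + 1) \<in> B"
      using False fin(2) nth_mem[of _ "sorted_list_of_set B"] by (auto simp: zs_def nth_append)
    then show ?thesis by (rule lab(2))
  qed
  ultimately show ?thesis using that by blast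
qed

text \<open>Two coins with the same label, put on opposite pans of one scale, load it evenly, and
  whichever way the scale tips one of the two is cleared. So \<open>m\<close> pairs on each scale and at most
  \<open>m\<close> coins aside leave at most \<open>m\<close> candidates in every case.\<close>

lemma labelled_step:
  assumes z: "bij_betw z {..<card C} C" and C: "C \<subseteq> {..<N}"
    and pair: "\<And>i. 2 * i + 1 < card C \<Longrightarrow> lab (z (2 * i)) = lab (z (2 * i + 1))"
    and cardC: "card C \<le> (2 * k + 1) * m" and m: "m > 0"
  obtains p where "valid_placement N k p"
    and "card {c \<in> C. p c = None} \<le> m"
    and "\<And>s b. card {c \<in> C. p c = Some (s, rising_pan (c, lab c) b)} \<le> m"
proof -
  have inj: "inj_on z {..<card C}" and img: "z ` {..<card C} = C"
    using z by (auto simp: bij_betw_def)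
  have finC: "finite C" using C finite_subset by blast
  define X where "X = 2 * min (card C div 2) (k * m)"
  have X: "X \<le> card C" "X \<le> k * (2 * m)" "even X" by (auto simp: X_def)
  have "even (min (2 * m) (X - s * (2 * m)))" for s
    using X(3) by (simp add: min_def)
  with block_placement[OF inj _ X(1,2), where g = id and v = 0] img C m
  obtain p where p: "valid_placement N k p"
    and pz: "\<And>i. i < card C \<Longrightarrow>
      p (z i) = (if i < X then Some (i div (2 * m), pan_of (i mod (2 * m))) else None)"
    by auto
  have "{c \<in> C. p c = None} = z ` {X..<card C}"
  proof (intro equalityI subsetI)
    fix c assume c: "c \<in> {c \<in> C. p c = None}"
    then obtain i where "c = z i" "i < card C" using img by auto
    then show "c \<in> z ` {X..<card C}" using c pz by (auto split: if_splits)
  qed (use pz img in auto)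
  then have "card {c \<in> C. p c = None} \<le> card C - X"
    using card_image_le[of "{X..<card C}" z] by simp
  also have "\<dots> \<le> m"
    using cardC m unfolding X_def by (cases "card C div 2 \<le> k * m") (auto simp: algebra_simps)
  finally have aside: "card {c \<in> C. p c = None} \<le> m" .
  have tip: "card {c \<in> C. p c = Some (s, rising_pan (c, lab c) b)} \<le> m" (is "card ?T \<le> m") for s b
  proof -
    let ?I = "{i. i < card C \<and> z i \<in> ?T}"
    have I: "i < X" "i div 2 div m = s" "pan_of i = rising_pan (z i, lab (z i)) b"
      if "i \<in> ?I" for i
    proof -
      have "p (z i) = Some (s, rising_pan (z i, lab (z i)) b)" using that by simp
      moreover have "even (i mod (2 * m)) = even i" by (simp add: dvd_mod_iff)
      ultimately show "i < X" "i div 2 div m = s" "pan_of i = rising_pan (z i, lab (z i)) b"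
        using that pz by (auto simp: pan_of_def div_mult2_eq split: if_splits)
    qed
    have "card ?T \<le> card ?I"
      by (rule surj_card_le[of _ _ z]) (use img in auto)
    also have "card ?I = card ((\<lambda>i. i div 2) ` ?I)"
    proof (rule card_image[symmetric], rule inj_onI)
      fix i j assume ij: "i \<in> ?I" "j \<in> ?I" "i div 2 = j div 2"
      have lab_even: "lab (z i) = lab (z (2 * (i div 2)))" if "i \<in> ?I" for i
      proof (cases "even i")
        case False
        then have "i = 2 * (i div 2) + 1" by simp
        then show ?thesis using pair[of "i div 2"] that by auto
      qed simp
      have "lab (z i) = lab (z j)"
        using lab_even[OF ij(1)] lab_even[OF ij(2)] ij(3) by simp
      then have "pan_of i = pan_of j"
        using I(3)[OF ij(1)] I(3)[OF ij(2)] by (simp add: rising_pan_def)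
      then have "even i = even j" by (auto simp: pan_of_def split: if_splits)
      then show "i = j" using ij(3) by presburger
    qed
    also have "\<dots> \<le> card {s * m..<s * m + m}"
    proof (rule card_mono)
      show "(\<lambda>i. i div 2) ` ?I \<subseteq> {s * m..<s * m + m}"
      proof
        fix q assume "q \<in> (\<lambda>i. i div 2) ` ?I"
        then have "q div m = s" using I(2) by auto
        then have "q = s * m + q mod m" by auto
        moreover have "q mod m < m" using m by simp
        ultimately show "q \<in> {s * m..<s * m + m}" by auto
      qed
    qed simp
    finally show ?thesis by simp
  qed
  show ?thesis using that p aside tip by blast
qed

text \<open>Pairing fails only when the numbers of possibly light and of possibly heavy coins are both
  odd. Then their total is even, hence below the odd number \<open>(2 k + 1) ^ j\<close>, and there is room to
  count the genuine coin \<open>g\<close> as one more suspect.\<close>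

lemma solvable_labelled:
  assumes "C \<subseteq> {..<N}" "g < N" "g \<notin> C" "card C \<le> (2 * k + 1) ^ j"
  shows "solvable N k j {x. fst x \<in> C \<and> snd x = lab (fst x)}"
  using assms
proof (induction j arbitrary: C)
  case 0
  then have "card C \<le> 1" "finite C" using finite_subset[of C "{..<N}"] by auto
  then have "\<exists>c. C \<subseteq> {c}" by (simp add: card_le_Suc0_iff_eq) blast
  then show ?case by auto
next
  case (Suc j)
  let ?m = "(2 * k + 1) ^ j"
  have finC: "finite C" using Suc.prems finite_subset by blast
  have split: "card C = card {c \<in> C. lab c} + card {c \<in> C. \<not> lab c}"
    using finC by (subst card_Un_disjoint[symmetric]) (auto intro: arg_cong[where f = card])
  obtain D where D: "C \<subseteq> D" "D \<subseteq> {..<N}" "card D \<le> (2 * k + 1) * ?m"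
    and ev: "even (card {c \<in> D. lab c}) \<or> even (card {c \<in> D. \<not> lab c})"
  proof (cases "even (card {c \<in> C. lab c}) \<or> even (card {c \<in> C. \<not> lab c})")
    case True
    then show ?thesis using that[of C] Suc.prems by simp
  next
    case False
    have "card C \<noteq> (2 * k + 1) ^ Suc j"
    proof
      assume "card C = (2 * k + 1) ^ Suc j"
      then have "odd (card C)" by (simp del: power_Suc)
      then show False using False split by simp
    qed
    then have "card (insert g C) \<le> (2 * k + 1) * ?m"
      using Suc.prems finC by simp
    moreover have "even (card {c \<in> insert g C. lab c}) \<or> even (card {c \<in> insert g C. \<not> lab c})"
    proof (cases "lab g")
      case True
      then have "{c \<in> insert g C. lab c} = insert g {c \<in> C. lab c}" by auto
      then show ?thesis using False finC Suc.prems by simp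
    next
      case not: False
      then have "{c \<in> insert g C. \<not> lab c} = insert g {c \<in> C. \<not> lab c}" by auto
      then show ?thesis using False finC Suc.prems by simp
    qed
    ultimately show ?thesis using that[of "insert g C"] Suc.prems by auto
  qed
  have finD: "finite D" using D finite_subset by blast
  obtain z where "bij_betw z {..<card D} D"
    "\<And>i. 2 * i + 1 < card D \<Longrightarrow> lab (z (2 * i)) = lab (z (2 * i + 1))"
    using paired_enumeration[OF finD ev] by blast
  from labelled_step[OF this(1) D(2) this(2) D(3)]
  obtain p where p: "valid_placement N k p"
    and aside: "card {c \<in> D. p c = None} \<le> ?m"
    and tips: "\<And>s b. card {c \<in> D. p c = Some (s, rising_pan (c, lab c) b)} \<le> ?m"
    by auto
  have sub: "solvable N k j {x. fst x \<in> {c \<in> C. P c} \<and> snd x = lab (fst x)}"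
    if P: "card {c \<in> D. P c} \<le> ?m" for P
  proof (rule Suc.IH)
    have "card {c \<in> C. P c} \<le> card {c \<in> D. P c}" using D finD by (intro card_mono) auto
    then show "card {c \<in> C. P c} \<le> ?m" using P by simp
  qed (use Suc.prems in auto)
  show ?case
  proof (rule solvable_SucI[OF p])
    show "solvable N k j {x \<in> {x. fst x \<in> C \<and> snd x = lab (fst x)}. p (fst x) = None}"
      by (rule solvable_mono[OF sub[OF aside]]) auto
    show "solvable N k j
        {x \<in> {x. fst x \<in> C \<and> snd x = lab (fst x)}. p (fst x) = Some (s, rising_pan x b)}" for s b
      by (rule solvable_mono[OF sub[OF tips[of s b]]]) (auto simp: rising_pan_def)
  qed (use Suc.prems in auto)
qed

section \<open>Coins whose possible deviation is unknown\<close>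

text \<open>When a scale tips, each suspect on it becomes a possibly light or a possibly heavy coin
  according to its pan, and every other coin is genuine; one coin left aside guarantees that such
  a coin exists, as is needed for the labelled search.\<close>

lemma solvable_unknown_step:
  assumes z: "bij_betw z {..<u} U" and U: "U \<subseteq> {..<N}"
    and p: "valid_placement N k p"
    and pz: "\<And>i. i < u \<Longrightarrow> p (z i) = (if i < X then Some (i div d, pan_of (i mod d)) else None)"
    and X: "X < u" and d: "0 < d" "d \<le> (2 * k + 1) ^ j"
    and aside: "solvable N k j (z ` {X..<u} \<times> UNIV)"
  shows "solvable N k (Suc j) (U \<times> UNIV)"
proof (rule solvable_SucI[OF p])
  have img: "z ` {..<u} = U" using z by (simp add: bij_betw_def)
  show "fst ` (U \<times> UNIV) \<subseteq> {..<N}" using U by auto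
  have "c \<in> z ` {X..<u}" if c: "c \<in> U" "p c = None" for c
  proof -
    from c(1) obtain i where "c = z i" "i < u" using img by auto
    then show ?thesis using c(2) pz by (auto split: if_splits)
  qed
  then show "solvable N k j {x \<in> U \<times> UNIV. p (fst x) = None}"
    by (intro solvable_mono[OF aside]) auto
next
  fix s b assume "s < k"
  have img: "z ` {..<u} = U" using z by (simp add: bij_betw_def)
  define C where "C = {c \<in> U. \<exists>a. p c = Some (s, a)}"
  have "C \<subseteq> z ` {i. i < X \<and> i div d = s \<and> True}"
  proof
    fix c assume "c \<in> C"
    then obtain i where "c = z i" "i < u" "\<exists>a. p (z i) = Some (s, a)"
      using img by (auto simp: C_def)
    then show "c \<in> z ` {i. i < X \<and> i div d = s \<and> True}" using pz by (auto split: if_splits)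
  qed
  then have "card C \<le> card {i. i < X \<and> i div d = s \<and> True}"
    by (intro surj_card_le) auto
  also have "\<dots> = min d (X - s * d)" by (subst card_block[OF d(1)]) (simp del: min_less_iff_conj)
  finally have "card C \<le> (2 * k + 1) ^ j" using d(2) by simp
  moreover have "z X < N" "z X \<notin> C" using X pz img U by (auto simp: C_def)
  moreover have "C \<subseteq> {..<N}" using U by (auto simp: C_def)
  ultimately have "solvable N k j {x. fst x \<in> C \<and> snd x = (p (fst x) = Some (s, b))}"
    by (intro solvable_labelled)
  then show "solvable N k j {x \<in> U \<times> UNIV. p (fst x) = Some (s, rising_pan x b)}"
    by (rule solvable_mono) (auto simp: C_def rising_pan_def)
qed

text \<open>With genuine coins at hand every scale can take the odd number \<open>(2 k + 1) ^ (j - 1)\<close> of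
  suspects. A borrowed coin is needed on at most \<open>k\<close> scales, and on at most as many scales as there are suspects
  weighed, whence the two alternatives for the supply \<open>G\<close>.\<close>

lemma solvable_unknown:
  assumes "U \<subseteq> {..<N}" "G \<subseteq> {..<N}" "U \<inter> G = {}"
    and "k \<le> card G \<or> card U \<le> card G + 1"
    and "2 * card U \<le> (2 * k + 1) ^ j + 1"
  shows "solvable N k j (U \<times> UNIV)"
  using assms
proof (induction j arbitrary: U)
  case 0
  then have "card U \<le> 1" "finite U" using finite_subset[of U "{..<N}"] by auto
  then have "\<exists>c. U \<subseteq> {c}" by (simp add: card_le_Suc0_iff_eq) blast
  then show ?case by auto
next
  case (Suc j)
  let ?m = "(2 * k + 1) ^ j"
  have fin: "finite U" "finite G"
    using Suc.prems(1,2) finite_subset[OF _ finite_lessThan] by blast+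
  show ?case
  proof (cases "U = {}")
    case True
    then show ?thesis using solvable_empty[of N k "Suc j"] by simp
  next
    case False
    then have u: "card U > 0" using fin by (simp add: card_gt_0_iff)
    define X where "X = min (card U - 1) (k * ?m)"
    have X: "X < card U" "X \<le> k * ?m" using u by (auto simp: X_def)
    have m: "?m > 0" by simp
    obtain z where z: "bij_betw z {..<card U} U"
      using ex_bij_betw_nat_finite[OF fin(1)] by (auto simp: atLeast0LessThan)
    obtain g where g: "bij_betw g {..<card G} G"
      using ex_bij_betw_nat_finite[OF fin(2)] by (auto simp: atLeast0LessThan)
    have img: "z ` {..<card U} = U" using z by (simp add: bij_betw_def)
    have borrow: "s < card G" if s: "s < k" "odd (min ?m (X - s * ?m))" for s
    proof -
      have "X - s * ?m \<noteq> 0"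
      proof
        assume "X - s * ?m = 0"
        with s(2) show False by simp
      qed
      then have "s * ?m < X" by simp
      moreover have "s * 1 \<le> s * ?m" using m by (intro mult_le_mono2) simp
      ultimately have "s * 1 < X" by (rule le_less_trans[rotated])
      then have "s < X" by simp
      then show ?thesis using s(1) X(1) Suc.prems(4) by auto
    qed
    have g2: "g ` {..<card G} \<subseteq> {..<N} - z ` {..<card U}"
      using g Suc.prems img by (auto simp: bij_betw_def)
    obtain p where p: "valid_placement N k p"
      and pz: "\<And>i. i < card U \<Longrightarrow>
        p (z i) = (if i < X then Some (i div ?m, pan_of (i mod ?m)) else None)"
      using block_placement[of z "card U" N X k ?m g "card G", OF _ _ _ X(2) m _ g2 borrow]
        z g X(1) Suc.prems(1) img by (auto simp: bij_betw_def)
    let ?V = "z ` {X..<card U}"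
    have cV: "card ?V \<le> card U - X" using card_image_le[of "{X..<card U}" z] by simp
    have VU: "?V \<subseteq> U" using img by auto
    have "solvable N k j (?V \<times> UNIV)"
    proof (rule Suc.IH)
      show "k \<le> card G \<or> card ?V \<le> card G + 1" using cV Suc.prems(4) by linarith
      have "2 * (card U - X) \<le> ?m + 1"
      proof (cases "card U - 1 \<le> k * ?m")
        case True
        then have "card U - X \<le> 1" by (simp add: X_def)
        then show ?thesis using m by linarith
      next
        case False
        then have "X = k * ?m" by (simp add: X_def)
        moreover have "2 * card U \<le> 2 * (k * ?m) + ?m + 1"
          using Suc.prems(5) by (simp add: algebra_simps)
        ultimately show ?thesis by linarith
      qed
      then show "2 * card ?V \<le> ?m + 1" using cV by linarith
    qed (use VU Suc.prems in auto)
    then show ?thesis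
      using solvable_unknown_step[OF z Suc.prems(1) p pz X(1) m] by blast
  qed
qed

text \<open>In the first minute nothing can be borrowed, so a scale takes at most the even number
  \<open>m - 1\<close> of coins, where \<open>m = (2 k + 1) ^ (n - 1)\<close>; this costs one coin per scale, the term
  \<open>k\<close> in the bound. If everything balances, the coins weighed form the supply of genuine ones. One coin or two must stay aside
  for parity and for the labelled search, hence the cap \<open>2 * ((N - 1) div 2)\<close>.\<close>

lemma solvable_all:
  assumes k: "k \<ge> 1" and N: "3 \<le> N" and bound: "2 * N + 2 * k \<le> (2 * k + 1) ^ n + 1"
  shows "solvable N k n ({..<N} \<times> UNIV)"
proof -
  have "n \<noteq> 0" using bound N by (cases n) auto
  then obtain j where j: "n = Suc j" using not0_implies_Suc by blast
  have "j \<noteq> 0" using bound N j by (cases j) auto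
  define m where "m = (2 * k + 1) ^ j"
  have "(2 * k + 1) ^ 1 \<le> m" unfolding m_def using \<open>j \<noteq> 0\<close> by (intro power_increasing) auto
  then have m: "m \<ge> 3" "odd m" using k by (auto simp: m_def)
  have km: "k * (m - 1) + k = k * m" using m by (cases m) auto
  have kk: "k * 1 \<le> k * (m - 1)" using m by (intro mult_le_mono2) simp
  have bnd: "2 * N + 2 * k \<le> 2 * (k * m) + m + 1"
    using bound by (simp add: j m_def algebra_simps)
  define X where "X = min (2 * ((N - 1) div 2)) (k * (m - 1))"
  have X: "X < N" "X \<le> k * (m - 1)" "even X" using N m by (auto simp: X_def min_def)
  have z: "bij_betw id {..<N} {..<N}" by simp
  have "even (min (m - 1) (X - s * (m - 1)))" for s
    using X(3) m by (simp add: min_def)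
  then obtain p where p: "valid_placement N k p"
    and pz: "\<And>i. i < N \<Longrightarrow>
      p (id i) = (if i < X then Some (i div (m - 1), pan_of (i mod (m - 1))) else None)"
    using block_placement[of id N N X k "m - 1" id 0] X m by auto
  have "solvable N k j ({X..<N} \<times> UNIV)"
  proof (rule solvable_unknown[where G = "{..<X}"])
    have cases_X: "X = k * (m - 1) \<or> N - X \<le> 2 \<and> X \<ge> 2" using N by (auto simp: X_def min_def)
    then show "k \<le> card {..<X} \<or> card {X..<N} \<le> card {..<X} + 1" using kk by auto
    show "2 * card {X..<N} \<le> (2 * k + 1) ^ j + 1"
      using cases_X bnd km m unfolding m_def[symmetric] card_atLeastLessThan by linarith
  qed (use X in auto)
  then show ?thesis
    using solvable_unknown_step[OF z _ p pz X(1), of j] m unfolding j by (simp add: m_def)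
qed

theorem mainTheorem6:
  fixes k n N :: nat
  assumes "k \<ge> 1" and "n \<ge> 1"
    and "3 \<le> N"
    and "real N \<le> ((2 * real k + 1) ^ n + 1) / 2 - real k"
  shows "\<exists>\<sigma> verdict. finds_fake N k n \<sigma> verdict"
proof -
  have "real (2 * N + 2 * k) \<le> real ((2 * k + 1) ^ n + 1)"
    using assms(4) by (simp add: field_simps)
  then have "2 * N + 2 * k \<le> (2 * k + 1) ^ n + 1" by (simp only: of_nat_le_iff)
  from solvable_strategy[OF solvable_all[OF assms(1,3) this]]
  show ?thesis unfolding finds_fake_def fake_coin_def by (auto; metis)
qed

end
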